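(* Let $N\geq2$, $s\in(0,1)$, let $\Omega\subset\mathbb{R}^N$ be a radial open set, let $f:[0,\infty)\times\mathbb{R}\to\mathbb{R}$ satisfy (F1) and (F2) below, and suppose there are constants $a_1,a_2$ and $q\in[2,\frac{2N}{N-2s}]$ such that $|f(r,u)|\leq a_1|u|+a_2|u|^{q-1}$ for all $r\geq0$, $u\in\mathbb{R}$. Let $F(r,u)=\int_0^u f(r,\tau)\,d\tau$ and \[K:\mathcal{H}^s_0(\Omega)\to\mathbb{R},\quad K[u]=\frac{c_{N,s}}{4}\int_{\mathbb{R}^N}\int_{\mathbb{R}^N}\frac{(u(x)-u(y))^2}{|x-y|^{N+2s}}\,dxdy-\int_\Omega F(|x|,u(x))\,dx.\] Assume $u\in\mathcal{H}^s_0(\Omega)$ satisfies either (1) $u$ is a continuous bounded global minimizer of $K$, or (2) $u$ is a continuous bounded minimizer of $K$ subject to the constraint $\|u\|_{L^q(\Omega)}^q=1$. If in addition $\lim_{|x|\to\infty}u(x)=0$, then $u$ is foliated Schwarz symmetric in $\Omega$ (with respect to some $p\in S^{N-1}$).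
   Context: A set is radial if it is invariant under all rotations about the origin; $S^{N-1}$ is the unit sphere. $\mathcal{H}^s_0(\Omega)=\{u\in L^2(\mathbb{R}^N):\int\int\frac{(u(x)-u(y))^2}{|x-y|^{N+2s}}dxdy<\infty,\ u\equiv0\text{ on }\mathbb{R}^N\setminus\Omega\}$; $c_{N,s}=s(1-s)\pi^{-N/2}4^s\frac{\Gamma(\frac{N+2s}{2})}{\Gamma(1-s)}$. (F1): for every $K>0$ there is $L=L(K)>0$ with $\sup_{r\geq0}|f(r,u)-f(r,v)|\leq L|u-v|$ for all $u,v\in[-K,K]$. (F2): $f(r,0)=0$ for all $r\geq0$, and there is $\delta>0$ with $\sup_{r\geq0}\frac{f(r,u)}{u}\leq0$ for all $u\in[-\delta,\delta]\setminus\{0\}$. For a radial set $D$ and $p\in S^{N-1}$, $u:D\to\mathbb{R}$ is foliated Schwarz symmetric with respect to $p$ in $D$ if for every $r>0$ with $rS^{N-1}\subset D$ and every $c\in\mathbb{R}$, the set $\{x\in rS^{N-1}:u(x)\geq c\}$ is either all of $rS^{N-1}$ or a geodesic ball in $rS^{N-1}$ centered at $rp$. *)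

theory Defs
  imports "HOL-Analysis.Analysis"
begin

definition rotation :: "(real^'n \<Rightarrow> real^'n) \<Rightarrow> bool" where
  "rotation g \<longleftrightarrow> orthogonal_transformation g \<and> det (matrix g) = 1"

definition radial_set :: "(real^'n) set \<Rightarrow> bool" where
  "radial_set D \<longleftrightarrow> (\<forall>g. rotation g \<longrightarrow> g ` D = D)"

definition cNs :: "nat \<Rightarrow> real \<Rightarrow> real" where
  "cNs N s = s * (1 - s) * pi powr (- real N / 2) * 4 powr s
             * Gamma ((real N + 2 * s) / 2) / Gamma (1 - s)"

definition gagliardo :: "real \<Rightarrow> (real^'n \<Rightarrow> real) \<Rightarrow> ennreal" where
  "gagliardo s u = (\<integral>\<^sup>+ z. ennreal ((u (fst z) - u (snd z))\<^sup>2
        / norm (fst z - snd z) powr (real CARD('n) + 2 * s)) \<partial>(lebesgue \<Otimes>\<^sub>M lebesgue))"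

definition Hs0 :: "real \<Rightarrow> (real^'n) set \<Rightarrow> (real^'n \<Rightarrow> real) set" where
  "Hs0 s \<Omega> = {u. u \<in> borel_measurable lebesgue \<and> integrable lebesgue (\<lambda>x. (u x)\<^sup>2)
        \<and> gagliardo s u < \<infinity> \<and> (\<forall>x. x \<notin> \<Omega> \<longrightarrow> u x = 0)}"

definition primitive :: "(real \<Rightarrow> real \<Rightarrow> real) \<Rightarrow> real \<Rightarrow> real \<Rightarrow> real" where
  "primitive f r u = (LBINT \<tau>=0..u. f r \<tau>)"

definition energy :: "real \<Rightarrow> (real^'n) set \<Rightarrow> (real \<Rightarrow> real \<Rightarrow> real)
     \<Rightarrow> (real^'n \<Rightarrow> real) \<Rightarrow> real" where
  "energy s \<Omega> f u = cNs CARD('n) s / 4 * enn2real (gagliardo s u)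
      - (LINT x:\<Omega>|lebesgue. primitive f (norm x) (u x))"

definition Lq_pow :: "real \<Rightarrow> (real^'n) set \<Rightarrow> (real^'n \<Rightarrow> real) \<Rightarrow> real" where
  "Lq_pow q \<Omega> u = (LINT x:\<Omega>|lebesgue. \<bar>u x\<bar> powr q)"

text \<open>Geodesic ball in r S^{N-1} centred at r p with angular radius rho
  (geodesic radius r*rho), open or closed.\<close>
definition geodesic_ball :: "real \<Rightarrow> real^'n \<Rightarrow> real \<Rightarrow> (real^'n) set \<Rightarrow> bool" where
  "geodesic_ball r p \<rho> B \<longleftrightarrow> 0 \<le> \<rho> \<and>
     (B = {x \<in> sphere 0 r. arccos ((x \<bullet> p) / r) < \<rho>}
      \<or> B = {x \<in> sphere 0 r. arccos ((x \<bullet> p) / r) \<le> \<rho>})"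

definition foliated_schwarz :: "(real^'n) set \<Rightarrow> real^'n \<Rightarrow> (real^'n \<Rightarrow> real) \<Rightarrow> bool" where
  "foliated_schwarz D p u \<longleftrightarrow>
     (\<forall>r>0. sphere 0 r \<subseteq> D \<longrightarrow> (\<forall>c::real.
        let S = {x \<in> sphere 0 r. u x \<ge> c} in
        S = sphere 0 r \<or> (\<exists>\<rho>. geodesic_ball r p \<rho> S)))"

end

(* For e in R^N let d(x) = (x . e) (u(x) - u(x')), where x' is the mirror image of x in the
   hyperplane orthogonal to e. Polarization replaces u(x) by u(x') wherever d(x) < 0. It merely
   rearranges values on spheres around 0, so the potential term and the L^q constraint are unchanged,
   while the nonlocal form never increases and strictly decreases if d takes both signs: the kernel
   is strictly decreasing, so pairs (x, y) with d(x) < 0 < d(y) contribute a strict gain. Hence for a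
   minimizer d has a constant sign for every e. The sign is that of e . M_R with M_R the integral of
   u(x) x over the ball of radius R around 0, unless e . M_R = 0. If all M_R vanish, u is
   radial; otherwise u increases on each sphere in the direction of M_R. *)
theory Submission
  imports Defs
begin

subsection \<open>Orthogonal invariance of Lebesgue measure\<close>

lemma sigma_finite_measure_balls:
  fixes M :: "'a::real_normed_vector measure"
  assumes "space M = UNIV"
    and "\<And>n::nat. ball 0 (real n) \<in> sets M" "\<And>n::nat. emeasure M (ball 0 (real n)) \<noteq> \<infinity>"
  shows "sigma_finite_measure M"
proof (unfold_locales, intro exI conjI)
  let ?A = "range (\<lambda>n::nat. ball (0::'a) (real n))"
  show "?A \<subseteq> sets M" "\<forall>A\<in>?A. emeasure M A \<noteq> \<infinity>"
    using assms(2,3) by auto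
  show "\<Union>?A = space M"
    by (auto simp: assms(1) reals_Archimedean2)
qed auto

text \<open>Uniqueness of Haar measure, by Fubini. The hypothesis on balls serves twice: the integer
  radii make \<open>M\<close> sigma-finite, as Fubini requires, and radius 1 fixes the
  constant.\<close>

lemma translation_invariant_eq_lborel:
  fixes M :: "'a::euclidean_space measure"
  assumes sets_M [measurable_cong]: "sets M = sets borel"
    and invariant: "\<And>a. distr M borel (\<lambda>x. x + a) = M"
    and ball: "\<And>r. emeasure M (ball 0 r) = emeasure lborel (ball (0::'a) r)"
  shows "M = lborel"
proof (rule measure_eqI)
  have space_M: "space M = UNIV"
    using sets_eq_imp_space_eq[OF sets_M] by simp
  interpret M: sigma_finite_measure M
    using emeasure_bounded_finite[OF bounded_ball]
    by (intro sigma_finite_measure_balls) (auto simp: space_M sets_M ball less_top)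
  interpret P: pair_sigma_finite M lborel ..
  have transM: "(\<integral>\<^sup>+x. g (x + a) \<partial>M) = (\<integral>\<^sup>+x. g x \<partial>M)"
    if [measurable]: "g \<in> borel_measurable borel" for g :: "'a \<Rightarrow> ennreal" and a
    by (subst (2) invariant[of a, symmetric]) (simp add: nn_integral_distr)
  \<comment> \<open>Used with \<open>c = 1\<close> and \<open>c = -1\<close>: for fixed x, both y
    \<mapsto> x + y and y \<mapsto> x - y preserve \<open>lborel\<close>.\<close>
  have affL: "(\<integral>\<^sup>+x. g (a + c *\<^sub>R x) \<partial>lborel) = (\<integral>\<^sup>+x. g x \<partial>lborel)"
    if [measurable]: "g \<in> borel_measurable borel" and "\<bar>c\<bar> = 1" for g :: "'a \<Rightarrow> ennreal" and a c
  proof -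
    have "c \<noteq> 0" using that by auto
    then have "lborel = distr lborel borel (\<lambda>x. a + c *\<^sub>R x)"
      using lborel_affine[of c a] that(2) by (simp add: density_1)
    then have "(\<integral>\<^sup>+x. g x \<partial>lborel) = (\<integral>\<^sup>+x. g x \<partial>distr lborel borel (\<lambda>x. a + c *\<^sub>R x))"
      by (rule arg_cong)
    then show ?thesis
      by (simp add: nn_integral_distr)
  qed
  fix A assume "A \<in> sets M"
  then have [measurable]: "A \<in> sets borel" using sets_M by simp
  define B where "B = ball (0::'a) 1"
  have [measurable]: "B \<in> sets borel" by (simp add: B_def)
  have ballB: "emeasure M B = emeasure lborel B" by (simp add: B_def ball)
  have affB: "(\<integral>\<^sup>+y. indicator B (x + 1 *\<^sub>R y) \<partial>lborel) = emeasure lborel B" for x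
    by (subst affL[of "indicator B"]) simp_all
  have affA: "(\<integral>\<^sup>+y. indicator A (x + (-1) *\<^sub>R y) \<partial>lborel) = emeasure lborel A" for x
    by (subst affL[of "indicator A"]) simp_all
  txt \<open>Evaluate the measure of pairs with x in A and x + y in B in both orders.\<close>
  have "emeasure M A * emeasure lborel B
      = (\<integral>\<^sup>+x. indicator A x * emeasure lborel B \<partial>M)"
    by (simp add: nn_integral_multc)
  also have "\<dots> = (\<integral>\<^sup>+x. indicator A x * (\<integral>\<^sup>+y. indicator B (x + 1 *\<^sub>R y) \<partial>lborel) \<partial>M)"
    by (simp only: affB)
  also have "\<dots> = (\<integral>\<^sup>+x. (\<integral>\<^sup>+y. indicator A x * indicator B (x + y) \<partial>lborel) \<partial>M)"
    by (simp add: nn_integral_cmult)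
  also have "\<dots> = (\<integral>\<^sup>+y. (\<integral>\<^sup>+x. indicator A x * indicator B (x + y) \<partial>M) \<partial>lborel)"
    by (rule P.Fubini'[symmetric]) simp
  also have "\<dots> = (\<integral>\<^sup>+y. (\<integral>\<^sup>+x. indicator A (x - y) * indicator B x \<partial>M) \<partial>lborel)"
  proof (rule nn_integral_cong)
    fix y
    show "(\<integral>\<^sup>+x. indicator A x * indicator B (x + y) \<partial>M)
        = (\<integral>\<^sup>+x. indicator A (x - y) * indicator B x \<partial>M)"
      using transM[of "\<lambda>x. indicator A (x - y) * indicator B x" y] by simp
  qed
  also have "\<dots> = (\<integral>\<^sup>+x. (\<integral>\<^sup>+y. indicator A (x - y) * indicator B x \<partial>lborel) \<partial>M)"
    by (rule P.Fubini') simp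
  also have "\<dots> = (\<integral>\<^sup>+x. (\<integral>\<^sup>+y. indicator A (x + (-1) *\<^sub>R y) \<partial>lborel) * indicator B x \<partial>M)"
    by (simp add: nn_integral_multc)
  also have "\<dots> = (\<integral>\<^sup>+x. emeasure lborel A * indicator B x \<partial>M)"
    by (simp only: affA)
  also have "\<dots> = emeasure lborel A * emeasure lborel B"
    by (simp add: nn_integral_cmult ballB)
  finally have "emeasure M A * emeasure lborel B = emeasure lborel A * emeasure lborel B" .
  \<comment> \<open>Cancelling this factor in \<open>ennreal\<close> requires it to be neither 0 nor
    infinite.\<close>
  moreover have "emeasure lborel B \<noteq> 0"
  proof
    assume "emeasure lborel B = 0"
    then have "B \<in> null_sets lborel" by (auto simp: null_sets_def)
    then have "negligible B"
      by (simp add: negligible_iff_null_sets null_sets_completionI)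
    then show False using open_not_negligible[of B] by (simp add: B_def)
  qed
  moreover have "emeasure lborel B \<noteq> \<infinity>"
    using emeasure_bounded_finite[OF bounded_ball, of "0::'a" 1] by (simp add: B_def less_top)
  ultimately show "emeasure M A = emeasure lborel A"
    by (metis ennreal_mult_divide_eq infinity_ennreal_def)
qed (use sets_M in simp)

text \<open>Linearity turns a translation by \<open>T b\<close> after \<open>T\<close> into one by
  \<open>b\<close> before it, so the image measure is again translation invariant; \<open>T\<close>
  preserves balls around 0, which gives the normalisation.\<close>

lemma distr_lborel_orthogonal:
  fixes T :: "'a::euclidean_space \<Rightarrow> 'a"
  assumes T: "orthogonal_transformation T"
  shows "distr lborel borel T = lborel"
proof (rule translation_invariant_eq_lborel)
  have lin: "linear T" using T by (rule orthogonal_transformation_linear)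
  then have [measurable]: "T \<in> borel_measurable borel"
    by (intro borel_measurable_continuous_onI linear_continuous_on linear_conv_bounded_linear[THEN iffD1])
  show "distr (distr lborel borel T) borel (\<lambda>x. x + a) = distr lborel borel T" for a
  proof -
    obtain b where b: "a = T b"
      using orthogonal_transformation_surj[OF T] by blast
    have "distr (distr lborel borel T) borel (\<lambda>x. x + a) = distr lborel borel (\<lambda>x. T (b + x))"
      by (subst distr_distr) (auto simp: o_def b linear_add[OF lin] add.commute)
    also have "\<dots> = distr (distr lborel borel ((+) b)) borel T"
      by (subst distr_distr) (auto simp: o_def)
    finally show ?thesis by (simp add: lborel_distr_plus)
  qed
  show "emeasure (distr lborel borel T) (ball 0 r) = emeasure lborel (ball (0::'a) r)" for r
  proof -
    have "T -` ball 0 r = ball 0 r"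
      using T by (auto simp: orthogonal_transformation)
    then show ?thesis by (simp add: emeasure_distr)
  qed
qed simp

text \<open>Passage to the completion: \<open>T\<close> carries \<open>lborel\<close> to itself, so
  preimages of Borel null sets are null.\<close>

lemma
  fixes T :: "'a::euclidean_space \<Rightarrow> 'a"
  assumes T: "orthogonal_transformation T"
  shows lebesgue_measurable_orthogonal: "T \<in> lebesgue \<rightarrow>\<^sub>M lebesgue"
    and distr_lebesgue_orthogonal: "distr lebesgue lebesgue T = lebesgue"
proof -
  have [measurable]: "T \<in> borel_measurable borel"
    using T by (intro borel_measurable_continuous_onI linear_continuous_on
        linear_conv_bounded_linear[THEN iffD1] orthogonal_transformation_linear)
  have d: "distr lebesgue lborel T = lborel"
    using distr_lborel_orthogonal[OF T]
    by (simp add: distr_completion cong: distr_cong)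
  show "T \<in> lebesgue \<rightarrow>\<^sub>M lebesgue"
    by (simp add: completion.measurable_completion2 d measurable_completion)
  show "distr lebesgue lebesgue T = lebesgue"
    by (subst completion.completion_distr_eq[symmetric]) (auto simp: d measurable_completion)
qed

lemma sigma_finite_lebesgue: "sigma_finite_measure (lebesgue :: 'a::euclidean_space measure)"
  using emeasure_bounded_finite[OF bounded_ball]
  by (intro sigma_finite_measure_balls) (auto simp: less_top)

text \<open>Serves to turn almost-everywhere information about continuous functions into pointwise
  information.\<close>

lemma emeasure_lebesgue_open_pos:
  fixes S :: "'a::euclidean_space set"
  assumes "open S" "S \<noteq> {}"
  shows "emeasure lebesgue S \<noteq> 0"
  using open_not_negligible[OF assms] assms(1)
  by (auto simp: negligible_iff_null_sets null_sets_def)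

subsection \<open>Reflections and polarization\<close>

text \<open>\<open>e\<close> is not normalised, so a difference of two points can be inserted
  directly. At \<open>e = 0\<close> the map is the identity.\<close>

definition mirror :: "'a::real_inner \<Rightarrow> 'a \<Rightarrow> 'a" where
  "mirror e x = x - (2 * (x \<bullet> e) / (e \<bullet> e)) *\<^sub>R e"

lemma linear_mirror: "linear (mirror e)"
  by (rule linearI) (simp_all add: mirror_def inner_add_left algebra_simps add_divide_distrib)

lemma inner_mirror [simp]: "mirror e x \<bullet> e = - (x \<bullet> e)"
  by (cases "e = 0") (simp_all add: mirror_def inner_diff_left)

lemma mirror_mirror [simp]: "mirror e (mirror e x) = x"
  by (subst (1) mirror_def) (simp, simp add: mirror_def)

lemma inner_mirror_mirror: "mirror e x \<bullet> mirror e y = x \<bullet> y"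
proof -
  have "mirror e x \<bullet> mirror e y
      = mirror e x \<bullet> y - (2 * (y \<bullet> e) / (e \<bullet> e)) * (mirror e x \<bullet> e)"
    by (subst (2) mirror_def) (simp add: inner_diff_right)
  also have "\<dots> = x \<bullet> y"
    by (simp, simp add: mirror_def inner_diff_left inner_commute[of e y])
  finally show ?thesis .
qed

lemma orthogonal_transformation_mirror: "orthogonal_transformation (mirror e)"
  by (simp add: orthogonal_transformation_def linear_mirror inner_mirror_mirror)

lemma norm_mirror [simp]: "norm (mirror e x) = norm x"
  by (simp add: norm_eq_sqrt_inner inner_mirror_mirror)

lemma norm_mirror_diff_mirror [simp]: "norm (mirror e x - mirror e y) = norm (x - y)"
  by (metis linear_diff linear_mirror norm_mirror)

lemma norm_mirror_diff: "norm (mirror e x - y) = norm (x - mirror e y)"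
  by (metis mirror_mirror norm_mirror_diff_mirror)

text \<open>The sign of (x . e)(y . e) thus decides which of y and its mirror image is nearer to x,
  and so which kernel value is larger.\<close>

lemma norm_diff_mirror:
  "(norm (x - mirror e y))\<^sup>2 = (norm (x - y))\<^sup>2 + 4 * ((x \<bullet> e) * (y \<bullet> e)) / (e \<bullet> e)"
proof -
  have "x \<bullet> mirror e y = x \<bullet> y - 2 * ((x \<bullet> e) * (y \<bullet> e)) / (e \<bullet> e)"
    by (simp add: mirror_def inner_diff_right)
  then show ?thesis
    by (simp add: power2_norm_eq_inner inner_diff_left inner_diff_right inner_mirror_mirror
        inner_commute[of y x] inner_commute[of "mirror e y" x])
qed

lemma inner_self_diff:
  assumes "norm x = norm y"
  shows "(x - y) \<bullet> (x - y) = 2 * (x \<bullet> (x - y))"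
  using assms by (simp add: norm_eq_sqrt_inner inner_diff_left inner_diff_right inner_commute[of y x])

lemma inner_self_diff_pos:
  assumes "norm x = norm y" "x \<noteq> y"
  shows "0 < x \<bullet> (x - y)"
proof -
  have "0 < (x - y) \<bullet> (x - y)" using assms(2) by simp
  then show ?thesis using inner_self_diff[OF assms(1)] by linarith
qed

text \<open>Converts a sign of \<open>tilt\<close> into a comparison of values of \<open>u\<close>
  at two arbitrary points of one sphere.\<close>

lemma mirror_diff_eq:
  assumes "norm x = norm y"
  shows "mirror (x - y) x = y"
proof (cases "x = y")
  case False
  have "2 * (x \<bullet> (x - y)) / ((x - y) \<bullet> (x - y)) = 1"
    using inner_self_diff[OF assms] inner_self_diff_pos[OF assms False]
    by (metis divide_self less_irrefl mult_eq_0_iff zero_neq_numeral)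
  then have "mirror (x - y) x = x - 1 *\<^sub>R (x - y)" by (simp only: mirror_def)
  then show ?thesis by simp
qed (simp add: mirror_def)

text \<open>The factor \<open>x \<bullet> e\<close> changes sign under the mirror together with the
  difference of values, so the product is mirror-invariant and no half-space has to be singled
  out.\<close>

definition tilt :: "'a::real_inner \<Rightarrow> ('a \<Rightarrow> real) \<Rightarrow> 'a \<Rightarrow> real" where
  "tilt e u x = (x \<bullet> e) * (u x - u (mirror e x))"

lemma tilt_mirror [simp]: "tilt e u (mirror e x) = tilt e u x"
  by (simp add: tilt_def algebra_simps)

lemma continuous_on_mirror: "continuous_on UNIV (mirror e)"
  unfolding mirror_def by (cases "e = 0") (auto intro!: continuous_intros)

lemma continuous_on_tilt:
  assumes u: "continuous_on UNIV u"
  shows "continuous_on UNIV (tilt e u)"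
  using continuous_on_compose2[OF u continuous_on_mirror[of e]]
  unfolding tilt_def by (auto intro!: continuous_intros u)

text \<open>Polarization is encoded as a map of points; the polarized function is \<open>u\<close>
  composed with it. On x . e > 0 this gives the larger of u(x) and u(x'), on x . e < 0 the smaller.
  Invariance of integrals reduces to properties of the map.\<close>

definition polar :: "'a::real_inner \<Rightarrow> ('a \<Rightarrow> real) \<Rightarrow> 'a \<Rightarrow> 'a" where
  "polar e u x = (if tilt e u x < 0 then mirror e x else x)"

lemma polar_polar [simp]: "polar e u (polar e u x) = x"
  by (simp add: polar_def)

lemma polar_mirror: "polar e u (mirror e x) = mirror e (polar e u x)"
  by (simp add: polar_def)

lemma norm_polar [simp]: "norm (polar e u x) = norm x"
  by (simp add: polar_def)

section \<open>Mirror orbits of pairs and the two-point inequality\<close>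

definition diff_quotient :: "real \<Rightarrow> ('a::real_normed_vector \<Rightarrow> real) \<Rightarrow> 'a \<Rightarrow> 'a \<Rightarrow> real" where
  "diff_quotient a u x y = (u x - u y)\<^sup>2 / norm (x - y) powr a"

text \<open>The polarization inequality for difference quotients holds pointwise only after summation
  over the four images of a pair under the mirror.\<close>
definition orbit_sum :: "('a::real_inner) \<Rightarrow> ('a \<Rightarrow> 'a \<Rightarrow> real) \<Rightarrow> 'a \<Rightarrow> 'a \<Rightarrow> real" where
  "orbit_sum e g x y = g x y + g (mirror e x) y + g x (mirror e y) + g (mirror e x) (mirror e y)"

lemma diff_quotient_nonneg [simp]: "0 \<le> diff_quotient a u x y"
  by (simp add: diff_quotient_def)

lemma diff_quotient_commute: "diff_quotient a u x y = diff_quotient a u y x"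
  by (simp add: diff_quotient_def norm_minus_commute power2_commute)

lemma orbit_sum_commute: "orbit_sum e (diff_quotient a u) x y = orbit_sum e (diff_quotient a u) y x"
  by (simp add: orbit_sum_def diff_quotient_commute[of a u y] diff_quotient_commute[of a u "mirror e y"])

lemma orbit_sum_diff_quotient:
  "orbit_sum e (diff_quotient a u) x y
    = ((u x - u y)\<^sup>2 + (u (mirror e x) - u (mirror e y))\<^sup>2) / norm (x - y) powr a
    + ((u (mirror e x) - u y)\<^sup>2 + (u x - u (mirror e y))\<^sup>2) / norm (x - mirror e y) powr a"
  by (simp add: orbit_sum_def diff_quotient_def norm_mirror_diff add_divide_distrib)

text \<open>When only x is moved, the numerators over the distances |x - y| and |x - y'| trade
  places. The orbit sum therefore falls by -2 P (k - k'), with P the product of the jumps of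
  \<open>u\<close> across the mirror at x and y, and k, k' the two kernel values.\<close>

lemma orbit_sum_polar_one:
  assumes a: "0 < a" and x: "tilt e u x < 0" and y: "0 \<le> tilt e u y"
  shows "orbit_sum e (diff_quotient a (\<lambda>x. u (polar e u x))) x y \<le> orbit_sum e (diff_quotient a u) x y"
    and "0 < tilt e u y \<Longrightarrow>
      orbit_sum e (diff_quotient a (\<lambda>x. u (polar e u x))) x y < orbit_sum e (diff_quotient a u) x y"
proof -
  let ?v = "\<lambda>x. u (polar e u x)"
  define k k' where "k = 1 / norm (x - y) powr a" and "k' = 1 / norm (x - mirror e y) powr a"
  define P where "P = (u x - u (mirror e x)) * (u y - u (mirror e y))"
  have swap: "((a - b)\<^sup>2 + (a' - b')\<^sup>2) / m + ((a' - b)\<^sup>2 + (a - b')\<^sup>2) / m'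
      - (((a' - b)\<^sup>2 + (a - b')\<^sup>2) / m + ((a - b)\<^sup>2 + (a' - b')\<^sup>2) / m')
      = - 2 * ((a - a') * (b - b') * (1 / m - 1 / m'))" for a a' b b' m m' :: real
    by (simp add: divide_inverse power2_eq_square algebra_simps)
  have polar_x: "polar e u x = mirror e x" and polar_y: "polar e u y = y"
    using x y by (simp_all add: polar_def)
  have diff: "orbit_sum e (diff_quotient a u) x y - orbit_sum e (diff_quotient a ?v) x y = - 2 * (P * (k - k'))"
    unfolding orbit_sum_diff_quotient polar_mirror polar_x polar_y mirror_mirror P_def k_def k'_def
    by (rule swap)
  have e: "0 < e \<bullet> e" using x by (auto simp: tilt_def)
  txt \<open>Points of unequal tilt are neither equal nor mirror images, which keeps the pair off the
    singular set, where division by zero would break the monotonicity of the kernel.\<close>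
  have "x \<noteq> y" "x \<noteq> mirror e y" using x y by auto
  then have n: "0 < norm (x - y)" "0 < norm (x - mirror e y)" by auto
  \<comment> \<open>\<open>w\<close> links the two factors: its sign is that of k - k', while
    \<open>w * P\<close> is the product of the tilts. Hence P and k - k' cannot have the same strict
    sign.\<close>
  define w where "w = (x \<bullet> e) * (y \<bullet> e)"
  have wP: "w * P = tilt e u x * tilt e u y" by (simp add: w_def P_def tilt_def)
  have sq: "(norm (x - mirror e y))\<^sup>2 - (norm (x - y))\<^sup>2 = 4 * w / (e \<bullet> e)"
    by (simp add: norm_diff_mirror w_def)
  have k_less: "k' < k" if "0 < w"
  proof -
    have "0 < 4 * w / (e \<bullet> e)" using that e by simp
    then have "norm (x - y) < norm (x - mirror e y)"
      using sq by (intro power_less_imp_less_base[of _ 2 "norm _"]) auto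
    then show ?thesis using n a by (simp add: k_def k'_def frac_less2 powr_less_mono2)
  qed
  have k_greater: "k < k'" if "w < 0"
  proof -
    have "4 * w / (e \<bullet> e) < 0" using that e by (simp add: divide_neg_pos)
    then have "norm (x - mirror e y) < norm (x - y)"
      using sq by (intro power_less_imp_less_base[of _ 2 "norm _"]) auto
    then show ?thesis using n a by (simp add: k_def k'_def frac_less2 powr_less_mono2)
  qed
  have k_eq: "k = k'" if "w = 0"
  proof -
    have "(norm (x - mirror e y))\<^sup>2 = (norm (x - y))\<^sup>2" using sq that by simp
    then have "norm (x - mirror e y) = norm (x - y)" by (rule power2_eq_imp_eq) simp_all
    then show ?thesis by (simp add: k_def k'_def)
  qed
  have "w * P \<le> 0" using x y unfolding wP by (simp add: mult_nonpos_nonneg)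
  then have "P * (k - k') \<le> 0"
    using k_less k_greater k_eq
    by (cases w "0::real" rule: linorder_cases) (auto simp: mult_le_0_iff)
  then show "orbit_sum e (diff_quotient a ?v) x y \<le> orbit_sum e (diff_quotient a u) x y"
    using diff by linarith
  assume "0 < tilt e u y"
  then have "w * P < 0" using x unfolding wP by (simp add: mult_neg_pos)
  then have "P * (k - k') < 0"
    using k_less k_greater by (auto simp: mult_less_0_iff)
  then show "orbit_sum e (diff_quotient a ?v) x y < orbit_sum e (diff_quotient a u) x y"
    using diff by linarith
qed

text \<open>If both points are moved or neither is, polarization only permutes the terms of the
  orbit sum; otherwise the mixed case applies, with x and y exchanged if necessary.\<close>

lemma orbit_sum_polar_le:
  assumes a: "0 < a"
  shows "orbit_sum e (diff_quotient a (\<lambda>x. u (polar e u x))) x y \<le> orbit_sum e (diff_quotient a u) x y"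
proof (cases "tilt e u x < 0 \<longleftrightarrow> tilt e u y < 0")
  case True
  then have "orbit_sum e (diff_quotient a (\<lambda>x. u (polar e u x))) x y = orbit_sum e (diff_quotient a u) x y"
    by (cases "tilt e u x < 0") (simp_all add: orbit_sum_diff_quotient polar_mirror, simp_all add: polar_def algebra_simps)
  then show ?thesis by simp
next
  case False
  then consider "tilt e u x < 0" "0 \<le> tilt e u y" | "tilt e u y < 0" "0 \<le> tilt e u x" by fastforce
  then show ?thesis
    using orbit_sum_polar_one(1)[OF a, of e u x y] orbit_sum_polar_one(1)[OF a, of e u y x]
    by cases (simp_all add: orbit_sum_commute[of _ _ _ x y])
qed

subsection \<open>Strict decrease of the nonlocal energy\<close>

text \<open>The nonlinearity may fail to be measurable in the radial variable, so \<open>g\<close> is arbitrary; if it is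
  not integrable, both integrals have the junk value 0.\<close>
lemma
  fixes g :: "'a \<Rightarrow> real"
  assumes T [measurable]: "T \<in> M \<rightarrow>\<^sub>M M" and distr: "distr M M T = M"
    and invol: "\<And>x. T (T x) = x"
  shows integrable_involution: "integrable M (\<lambda>x. g (T x)) \<longleftrightarrow> integrable M g"
    and integral_involution: "(LINT x|M. g (T x)) = (LINT x|M. g x)"
proof -
  have imp: "integrable M (\<lambda>x. h (T x))" if "integrable M h" for h :: "'a \<Rightarrow> real"
    using integrable_distr[OF T, of h] that by (simp add: distr)
  show iff: "integrable M (\<lambda>x. g (T x)) \<longleftrightarrow> integrable M g"
    using imp[of g] imp[of "\<lambda>x. g (T x)"] by (auto simp: invol)
  show "(LINT x|M. g (T x)) = (LINT x|M. g x)"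
  proof (cases "integrable M g")
    case True
    then have "g \<in> borel_measurable M" by simp
    from integral_distr[OF T this] show ?thesis by (simp add: distr)
  next
    case False
    then show ?thesis using iff by (simp add: not_integrable_integral_eq)
  qed
qed

text \<open>\<open>polar\<close> is the mirror on the set \<open>W\<close> of negative tilt and the
  identity off it. As \<open>W\<close> is mirror-invariant, the two pieces do not overlap, and each
  preserves measure.\<close>

lemma
  fixes u :: "'a::euclidean_space \<Rightarrow> real"
  assumes u [measurable]: "u \<in> borel_measurable lebesgue"
  shows measurable_polar: "polar e u \<in> lebesgue \<rightarrow>\<^sub>M lebesgue"
    and distr_polar: "distr lebesgue lebesgue (polar e u) = lebesgue"
proof -
  have m [measurable]: "mirror e \<in> lebesgue \<rightarrow>\<^sub>M lebesgue"
    and dm: "distr lebesgue lebesgue (mirror e) = lebesgue"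
    by (rule lebesgue_measurable_orthogonal distr_lebesgue_orthogonal,
        rule orthogonal_transformation_mirror)+
  have [measurable]: "(\<lambda>x. x \<bullet> e) \<in> borel_measurable lebesgue"
    by (rule measurable_completion) simp
  have [measurable]: "tilt e u \<in> borel_measurable lebesgue"
    unfolding tilt_def[abs_def] by measurable
  show p [measurable]: "polar e u \<in> lebesgue \<rightarrow>\<^sub>M lebesgue"
    unfolding polar_def[abs_def] by measurable
  define W where "W = {x. tilt e u x < 0}"
  have W [measurable]: "W \<in> sets lebesgue"
    using measurable_sets[of "tilt e u" lebesgue borel "{..<0}"] by (simp add: W_def vimage_def)
  show "distr lebesgue lebesgue (polar e u) = lebesgue"
  proof (rule measure_eqI)
    fix A assume "A \<in> sets (distr lebesgue lebesgue (polar e u))"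
    then have A [measurable]: "A \<in> sets lebesgue" by simp
    have "polar e u -` A = (A - W) \<union> (mirror e -` (A \<inter> W))"
      by (auto simp: polar_def W_def split: if_splits)
    moreover have "mirror e -` (A \<inter> W) \<in> sets lebesgue"
      using measurable_sets[OF m, of "A \<inter> W"] by auto
    moreover have "(A - W) \<inter> (mirror e -` (A \<inter> W)) = {}"
      by (auto simp: W_def)
    ultimately have "emeasure lebesgue (polar e u -` A)
        = emeasure lebesgue (A - W) + emeasure lebesgue (mirror e -` (A \<inter> W))"
      using A W by (simp only: plus_emeasure sets.Diff)
    also have "emeasure lebesgue (mirror e -` (A \<inter> W)) = emeasure lebesgue (A \<inter> W)"
      using emeasure_distr[OF m, of "A \<inter> W"] A W by (simp add: dm del: emeasure_completion)
    also have "emeasure lebesgue (A - W) + emeasure lebesgue (A \<inter> W) = emeasure lebesgue A"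
      using A W by (subst plus_emeasure) (auto simp: Un_Diff_Int simp del: emeasure_completion)
    finally show "emeasure (distr lebesgue lebesgue (polar e u)) A = emeasure lebesgue A"
      using emeasure_distr[OF p A] by (simp del: emeasure_completion)
  qed simp
qed

text \<open>Applying the mirror to either coordinate preserves the product measure, so the four
  terms have equal integrals. This carries pointwise orbit inequalities over to the double
  integral.\<close>

lemma nn_integral_orbit_sum:
  fixes G :: "'a::euclidean_space \<Rightarrow> 'a \<Rightarrow> real"
  assumes G: "(\<lambda>z. G (fst z) (snd z)) \<in> borel_measurable (lebesgue \<Otimes>\<^sub>M lebesgue)"
    and nonneg: "\<And>x y. 0 \<le> G x y"
  shows "(\<integral>\<^sup>+z. ennreal (orbit_sum e G (fst z) (snd z)) \<partial>(lebesgue \<Otimes>\<^sub>M lebesgue))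
    = 4 * (\<integral>\<^sup>+z. ennreal (G (fst z) (snd z)) \<partial>(lebesgue \<Otimes>\<^sub>M lebesgue))"
    and "(\<lambda>z. orbit_sum e G (fst z) (snd z)) \<in> borel_measurable (lebesgue \<Otimes>\<^sub>M lebesgue)"
proof -
  let ?L = "lebesgue :: 'a measure"
  let ?I = "\<integral>\<^sup>+z. ennreal (G (fst z) (snd z)) \<partial>(?L \<Otimes>\<^sub>M ?L)"
  have meas: "(\<lambda>z. G (S (fst z)) (T (snd z))) \<in> borel_measurable (?L \<Otimes>\<^sub>M ?L)"
    if [measurable]: "S \<in> ?L \<rightarrow>\<^sub>M ?L" "T \<in> ?L \<rightarrow>\<^sub>M ?L" for S T
    by (rule measurable_compose[where f="\<lambda>z. (S (fst z), T (snd z))", OF _ G, simplified]) measurable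
  have inv: "(\<integral>\<^sup>+z. ennreal (G (S (fst z)) (T (snd z))) \<partial>(?L \<Otimes>\<^sub>M ?L)) = ?I"
    if S [measurable]: "S \<in> ?L \<rightarrow>\<^sub>M ?L" and T [measurable]: "T \<in> ?L \<rightarrow>\<^sub>M ?L"
      and dS: "distr ?L ?L S = ?L" and dT: "distr ?L ?L T = ?L" for S T
  proof -
    have P [measurable]: "(\<lambda>(x, y). (S x, T y)) \<in> ?L \<Otimes>\<^sub>M ?L \<rightarrow>\<^sub>M ?L \<Otimes>\<^sub>M ?L"
      by measurable
    have d: "distr (?L \<Otimes>\<^sub>M ?L) (?L \<Otimes>\<^sub>M ?L) (\<lambda>(x, y). (S x, T y)) = ?L \<Otimes>\<^sub>M ?L"
      by (rule sym, rule pair_measure_distr[OF S T, unfolded dS dT]) (rule sigma_finite_lebesgue)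
    have "?I = (\<integral>\<^sup>+z. ennreal (G (fst z) (snd z))
        \<partial>distr (?L \<Otimes>\<^sub>M ?L) (?L \<Otimes>\<^sub>M ?L) (\<lambda>(x, y). (S x, T y)))"
      by (simp only: d)
    also have "\<dots> = (\<integral>\<^sup>+z. ennreal (G (S (fst z)) (T (snd z))) \<partial>(?L \<Otimes>\<^sub>M ?L))"
      using G by (subst nn_integral_distr[OF P]) (auto simp: case_prod_unfold)
    finally show ?thesis by simp
  qed
  have m: "mirror e \<in> ?L \<rightarrow>\<^sub>M ?L" "distr ?L ?L (mirror e) = ?L"
    by (rule lebesgue_measurable_orthogonal distr_lebesgue_orthogonal,
        rule orthogonal_transformation_mirror)+
  have i: "(\<lambda>x. x) \<in> ?L \<rightarrow>\<^sub>M ?L" "distr ?L ?L (\<lambda>x. x) = ?L"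
    by (simp_all add: distr_id[unfolded id_def])
  note [measurable] = G meas[OF m(1) i(1)] meas[OF i(1) m(1)] meas[OF m(1) m(1)]
  show "(\<lambda>z. orbit_sum e G (fst z) (snd z)) \<in> borel_measurable (?L \<Otimes>\<^sub>M ?L)"
    unfolding orbit_sum_def by measurable
  have four: "(4::ennreal) * c = c + c + c + c" for c
  proof -
    have "4 * c = (1 + 1 + 1 + 1) * c" by simp
    then show ?thesis by (simp only: distrib_right mult_1_left)
  qed
  show "(\<integral>\<^sup>+z. ennreal (orbit_sum e G (fst z) (snd z)) \<partial>(?L \<Otimes>\<^sub>M ?L)) = 4 * ?I"
    unfolding orbit_sum_def four
    by (simp add: ennreal_plus nonneg nn_integral_add inv[OF m(1) i(1) m(2) i(2)]
        inv[OF i(1) m(1) i(2) m(2)] inv[OF m(1) m(1) m(2) m(2)])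
qed

lemma measurable_diff_quotient:
  fixes u :: "'a::euclidean_space \<Rightarrow> real"
  assumes u [measurable]: "u \<in> borel_measurable lebesgue"
  shows "(\<lambda>z. diff_quotient a u (fst z) (snd z)) \<in> borel_measurable (lebesgue \<Otimes>\<^sub>M lebesgue)"
proof -
  have [measurable]: "(\<lambda>x. x) \<in> borel_measurable (lebesgue :: 'a measure)"
    by (rule measurable_completion) simp
  have [measurable]: "(\<lambda>z::'a \<times> 'a. fst z) \<in> borel_measurable (lebesgue \<Otimes>\<^sub>M lebesgue)"
     "(\<lambda>z::'a \<times> 'a. snd z) \<in> borel_measurable (lebesgue \<Otimes>\<^sub>M lebesgue)"
    by (rule measurable_compose[OF measurable_fst] measurable_compose[OF measurable_snd], measurable)+
  show ?thesis unfolding diff_quotient_def by measurable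
qed

text \<open>Integrating the orbit inequality gives the weak form. Continuity makes the sets of
  negative and of positive tilt open, so their product has positive measure, and there the
  inequality is strict; finite energy keeps the strictness under integration.\<close>

lemma gagliardo_polar_less:
  fixes u :: "real^'n \<Rightarrow> real"
  assumes s: "0 < s" and u: "continuous_on UNIV u" and fin: "gagliardo s u < \<infinity>"
    and neg: "tilt e u x0 < 0" and pos: "0 < tilt e u y0"
  shows "gagliardo s (\<lambda>x. u (polar e u x)) < gagliardo s u"
proof -
  let ?L = "lebesgue :: (real^'n) measure"
  define a where "a = real CARD('n) + 2 * s"
  have a: "0 < a" using s by (simp add: a_def add_nonneg_pos)
  interpret sigma_finite_measure ?L by (rule sigma_finite_lebesgue)
  have um [measurable]: "u \<in> borel_measurable ?L"
    by (intro measurable_completion) (simp add: borel_measurable_continuous_onI u)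
  have [measurable]: "polar e u \<in> ?L \<rightarrow>\<^sub>M ?L" by (rule measurable_polar[OF um])
  let ?v = "\<lambda>x. u (polar e u x)"
  have vm: "?v \<in> borel_measurable ?L" by measurable
  have gag: "gagliardo s w = (\<integral>\<^sup>+z. ennreal (diff_quotient a w (fst z) (snd z)) \<partial>(?L \<Otimes>\<^sub>M ?L))"
    for w :: "real^'n \<Rightarrow> real"
    by (simp add: gagliardo_def diff_quotient_def a_def)
  let ?Q = "\<lambda>w z. ennreal (orbit_sum e (diff_quotient a w) (fst z) (snd z))"
  have Q: "(\<integral>\<^sup>+z. ?Q w z \<partial>(?L \<Otimes>\<^sub>M ?L)) = 4 * gagliardo s w"
    and Qm: "?Q w \<in> borel_measurable (?L \<Otimes>\<^sub>M ?L)"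
    if "w \<in> borel_measurable ?L" for w
    using nn_integral_orbit_sum[OF measurable_diff_quotient[OF that, of a], of e]
    by (simp_all add: gag)
  have le: "?Q ?v z \<le> ?Q u z" for z
    by (intro ennreal_leI orbit_sum_polar_le a)
  define A B where "A = {x. tilt e u x < 0}" and "B = {x. 0 < tilt e u x}"
  have open_AB: "open A" "open B"
    unfolding A_def B_def by (intro open_Collect_less continuous_on_tilt[OF u] continuous_on_const)+
  \<comment> \<open>Otherwise \<open>A \<times> B\<close>, where the orbit sum drops strictly, would
    be a null set.\<close>
  have "\<not> (AE z in ?L \<Otimes>\<^sub>M ?L. ?Q u z \<le> ?Q ?v z)"
  proof
    assume AE: "AE z in ?L \<Otimes>\<^sub>M ?L. ?Q u z \<le> ?Q ?v z"
    have "AE z in ?L \<Otimes>\<^sub>M ?L. z \<notin> A \<times> B"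
      using AE
    proof (rule AE_mp, intro AE_I2 impI notI)
      fix z assume le: "?Q u z \<le> ?Q ?v z" and "z \<in> A \<times> B"
      then have "orbit_sum e (diff_quotient a ?v) (fst z) (snd z)
          < orbit_sum e (diff_quotient a u) (fst z) (snd z)"
        by (intro orbit_sum_polar_one(2) a) (auto simp: A_def B_def)
      moreover have "0 \<le> orbit_sum e (diff_quotient a ?v) (fst z) (snd z)"
        by (simp add: orbit_sum_def)
      ultimately have "?Q ?v z < ?Q u z" by (simp add: ennreal_less_iff)
      with le show False by simp
    qed
    then have "A \<times> B \<in> null_sets (?L \<Otimes>\<^sub>M ?L)"
      using open_AB by (subst AE_iff_null_sets) (auto intro!: pair_measureI)
    then have "emeasure ?L A * emeasure ?L B = 0"
      using open_AB by (subst emeasure_pair_measure_Times[symmetric]) auto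
    then show False
      using emeasure_lebesgue_open_pos[OF open_AB(1)] emeasure_lebesgue_open_pos[OF open_AB(2)]
        neg pos by (auto simp: A_def B_def)
  qed
  moreover have "(\<integral>\<^sup>+z. ?Q ?v z \<partial>(?L \<Otimes>\<^sub>M ?L)) \<noteq> \<infinity>"
  proof -
    have "(\<integral>\<^sup>+z. ?Q ?v z \<partial>(?L \<Otimes>\<^sub>M ?L)) \<le> 4 * gagliardo s u"
      unfolding Q[OF um, symmetric] by (intro nn_integral_mono le)
    also have "\<dots> < \<infinity>" using fin by (simp add: ennreal_mult_less_top)
    finally show ?thesis by simp
  qed
  ultimately have "4 * gagliardo s ?v < 4 * gagliardo s u"
    unfolding Q[OF um, symmetric] Q[OF vm, symmetric]
    by (intro nn_integral_less Qm um vm AE_I2 le)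
  then show ?thesis by (meson leD leI mult_left_mono zero_le)
qed

subsection \<open>The axis of symmetry\<close>

text \<open>The mirror preserves ball and measure and reverses x . e, so the two terms of the tilt
  contribute equally. Cutting off at a ball makes the moment of a merely continuous \<open>u\<close>
  integrable.\<close>

lemma integral_tilt:
  fixes u :: "'a::euclidean_space \<Rightarrow> real"
  assumes u: "continuous_on UNIV u"
  shows "(LINT x:cball 0 R|lebesgue. tilt e u x) = 2 * ((LINT x:cball 0 R|lebesgue. u x *\<^sub>R x) \<bullet> e)"
proof -
  have int: "integrable lebesgue (\<lambda>x. indicator (cball 0 R) x *\<^sub>R h x)"
    if "continuous_on UNIV h" for h :: "'a \<Rightarrow> 'b::euclidean_space"
    using borel_integrable_compact[of "cball 0 R" h] continuous_on_subset[OF that]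
    by (simp add: integrable_completion borel_measurable_continuous_onI that)
  define g where "g x = indicator (cball 0 R) x * (u x * (x \<bullet> e))" for x
  have g: "integrable lebesgue g"
    using int[of "\<lambda>x. u x * (x \<bullet> e)"] unfolding g_def[abs_def]
    by (simp add: continuous_intros u)
  have m: "mirror e \<in> lebesgue \<rightarrow>\<^sub>M lebesgue" "distr lebesgue lebesgue (mirror e) = lebesgue"
    by (rule lebesgue_measurable_orthogonal distr_lebesgue_orthogonal,
        rule orthogonal_transformation_mirror)+
  have "indicator (cball 0 R) x *\<^sub>R tilt e u x = g x + g (mirror e x)" for x
    by (simp add: g_def tilt_def indicator_def algebra_simps)
  then have "(LINT x:cball 0 R|lebesgue. tilt e u x) = (LINT x|lebesgue. g x + g (mirror e x))"
    by (simp add: set_lebesgue_integral_def)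
  also have "\<dots> = 2 * (LINT x|lebesgue. g x)"
    using g integrable_involution[OF m mirror_mirror, of g] integral_involution[OF m mirror_mirror, of g]
    by simp
  also have "(LINT x|lebesgue. g x) = (LINT x:cball 0 R|lebesgue. u x *\<^sub>R x) \<bullet> e"
    using integral_inner_left[OF int[of "\<lambda>x. u x *\<^sub>R x"], of e]
    by (simp add: set_lebesgue_integral_def g_def continuous_intros u mult.assoc)
  finally show ?thesis .
qed

text \<open>With zero moments, a tilt of constant sign has integral 0 over every ball; being
  continuous, it vanishes.\<close>

lemma tilt_eq_0:
  fixes u :: "'a::euclidean_space \<Rightarrow> real"
  assumes u: "continuous_on UNIV u"
    and sign: "(\<forall>x. 0 \<le> tilt e u x) \<or> (\<forall>x. tilt e u x \<le> 0)"
    and moment: "\<And>R. (LINT x:cball 0 R|lebesgue. u x *\<^sub>R x) = 0"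
  shows "tilt e u x = 0"
proof (rule ccontr)
  assume x: "tilt e u x \<noteq> 0"
  define R where "R = norm x + 1"
  \<comment> \<open>The factor \<open>c\<close> merges the two sign cases into one.\<close>
  obtain c :: real where c: "c \<noteq> 0" "\<And>y. 0 \<le> c * tilt e u y"
    using sign by (metis mult_1 mult_minus1 neg_0_le_iff_le zero_neq_neg_one zero_neq_one)
  define h where "h y = indicator (cball 0 R) y *\<^sub>R (c * tilt e u y)" for y
  have cont: "continuous_on UNIV (tilt e u)" by (rule continuous_on_tilt[OF u])
  have "integrable lebesgue h"
    unfolding h_def
    using borel_integrable_compact[of "cball 0 R" "\<lambda>y. c * tilt e u y"] continuous_on_subset[OF cont]
    by (simp add: integrable_completion borel_measurable_continuous_onI cont continuous_intros)
  moreover have "(LINT y|lebesgue. h y) = 0"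
    using integral_tilt[OF u, of R e] moment[of R]
    by (simp add: h_def set_lebesgue_integral_def mult.left_commute[of _ c])
  moreover have "0 \<le> h y" for y using c by (simp add: h_def)
  ultimately have "AE y in lebesgue. h y = 0"
    using integral_nonneg_eq_0_iff_AE[of lebesgue h] by simp
  \<comment> \<open>The open ball replaces the closed one so that the exceptional set is open;
    \<open>R\<close> was chosen so that it contains x.\<close>
  then have AE: "AE y in lebesgue. y \<notin> ball 0 R \<inter> {y. tilt e u y \<noteq> 0}"
    by (rule AE_mp) (auto simp: h_def c)
  have op: "open (ball 0 R \<inter> {y. tilt e u y \<noteq> 0})"
    by (intro open_Int open_ball open_Collect_neq cont continuous_on_const)
  then have "ball 0 R \<inter> {y. tilt e u y \<noteq> 0} \<in> null_sets lebesgue"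
    using AE by (subst AE_iff_null_sets) auto
  moreover have "x \<in> ball 0 R \<inter> {y. tilt e u y \<noteq> 0}" using x by (simp add: R_def)
  ultimately show False
    using emeasure_lebesgue_open_pos[OF op] null_setsD1 by blast
qed

lemma axial_monotone:
  fixes u :: "'a::euclidean_space \<Rightarrow> real"
  assumes u: "continuous_on UNIV u"
    and sign: "\<And>e. (\<forall>x. 0 \<le> tilt e u x) \<or> (\<forall>x. tilt e u x \<le> 0)"
  obtains p where "norm p = 1" "\<And>x y. norm x = norm y \<Longrightarrow> x \<bullet> p \<le> y \<bullet> p \<Longrightarrow> u x \<le> u y"
proof (cases "\<forall>R. (LINT x:cball 0 R|lebesgue. u x *\<^sub>R x) = 0")
  case True
  \<comment> \<open>Here every tilt vanishes and \<open>u\<close> is radial, so any unit vector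
    serves as axis.\<close>
  obtain p :: 'a where p: "norm p = 1" using vector_choose_size[of 1] by auto
  have const: "u x = u y" if "norm x = norm y" for x y
  proof (cases "x = y")
    case False
    then show ?thesis
      using inner_self_diff_pos[OF that]
        tilt_eq_0[OF u sign, of "x - y" x] True by (simp add: tilt_def mirror_diff_eq[OF that])
  qed simp
  show ?thesis by (rule that[OF p], rule eq_refl, rule const)
next
  case False
  then obtain R where "(LINT x:cball 0 R|lebesgue. u x *\<^sub>R x) \<noteq> 0" by blast
  define M where "M = (LINT x:cball 0 R|lebesgue. u x *\<^sub>R x)"
  have M: "M \<noteq> 0" using \<open>_ \<noteq> 0\<close> by (simp add: M_def)
  define p where "p = M /\<^sub>R norm M"
  have p: "norm p = 1" using M by (simp add: p_def)
  \<comment> \<open>One radius with nonzero moment suffices: the tilt has positive integral over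
    that ball, which excludes the nonpositive alternative.\<close>
  have pos: "0 \<le> tilt e u x" if "0 < p \<bullet> e" for e x
  proof -
    have "0 < M \<bullet> e" using that M by (simp add: p_def zero_less_mult_iff)
    then have "0 < (LINT x:cball 0 R|lebesgue. tilt e u x)"
      by (simp add: integral_tilt[OF u] M_def)
    moreover have "(LINT x:cball 0 R|lebesgue. tilt e u x) \<le> 0" if "\<forall>x. tilt e u x \<le> 0"
    proof -
      have "0 \<le> (LINT x|lebesgue. - (indicator (cball 0 R) x *\<^sub>R tilt e u x))"
        using that by (intro Bochner_Integration.integral_nonneg) (simp add: mult_nonneg_nonpos)
      then show ?thesis by (simp add: set_lebesgue_integral_def)
    qed
    ultimately show ?thesis using sign[of e] by force
  qed
  have "u x \<le> u y" if eq: "norm x = norm y" and le: "x \<bullet> p \<le> y \<bullet> p" for x y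
  proof (cases "x = y")
    case False
    \<comment> \<open>If x and y have equal height along p, the moment does not determine the sign
      for y - x. Adding \<open>t *\<^sub>R p\<close> makes the inner product with p positive, and t
      \<rightarrow> 0 recovers y - x.\<close>
    let ?e = "\<lambda>t. (y - x) + t *\<^sub>R p"
    \<comment> \<open>Keeps the division in \<open>mirror\<close> continuous at t = 0.\<close>
    have e0: "(y - x) \<bullet> (y - x) \<noteq> 0" using False by simp
    have "0 \<le> tilt (?e t) u y" if "0 < t" for t
    proof (rule pos)
      show "0 < p \<bullet> ?e t"
        using le that p by (simp add: inner_add_right inner_diff_right inner_commute[of p]
            flip: power2_norm_eq_inner)
    qed
    then have ev: "eventually (\<lambda>t. 0 \<le> tilt (?e t) u y) (at_right 0)"
      by (simp add: eventually_at_right_less eventually_mono[OF eventually_at_right_less])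
    have e_lim: "(?e \<longlongrightarrow> ?e 0) (at_right 0)"
      by (intro tendsto_intros)
    have uy: "isCont u z" for z using u by (simp add: continuous_on_eq_continuous_at)
    have "((\<lambda>t. tilt (?e t) u y) \<longlongrightarrow> tilt (?e 0) u y) (at_right 0)"
      unfolding tilt_def mirror_def using e0
      by (intro tendsto_intros e_lim isCont_tendsto_compose[OF uy]) simp
    from tendsto_lowerbound[OF this ev] have "0 \<le> tilt (y - x) u y" by simp
    then have "0 \<le> (y \<bullet> (y - x)) * (u y - u x)"
      by (simp add: tilt_def mirror_diff_eq[OF eq[symmetric]])
    moreover have "0 < y \<bullet> (y - x)"
      using False eq by (intro inner_self_diff_pos) auto
    ultimately show ?thesis by (simp add: zero_le_mult_iff)
  qed simp
  with p show ?thesis using that by blast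
qed

section \<open>From axial monotonicity to geodesic balls\<close>

lemma foliated_schwarz_axial_monotone:
  fixes u :: "real^'n \<Rightarrow> real"
  assumes u: "continuous_on UNIV u" and p: "norm p = 1"
    and mono: "\<And>x y. norm x = norm y \<Longrightarrow> x \<bullet> p \<le> y \<bullet> p \<Longrightarrow> u x \<le> u y"
  shows "foliated_schwarz D p u"
  unfolding foliated_schwarz_def Let_def
proof (intro allI impI)
  fix r c :: real assume r: "0 < r"
  let ?S = "{x \<in> sphere 0 r. c \<le> u x}"
  have bound: "\<bar>(x \<bullet> p) / r\<bar> \<le> 1" if "x \<in> sphere 0 r" for x
    using Cauchy_Schwarz_ineq2[of x p] that p r by simp
  show "?S = sphere 0 r \<or> (\<exists>\<rho>. geodesic_ball r p \<rho> ?S)"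
  proof (cases "?S = {}")
    case True
    have "0 \<le> arccos ((x \<bullet> p) / r)" if "x \<in> sphere 0 r" for x
      using bound[OF that] by (intro arccos_lbound) (simp_all add: abs_le_iff del: abs_divide)
    \<comment> \<open>An empty superlevel set is the open geodesic ball of radius 0.\<close>
    then have "{x \<in> sphere 0 r. arccos ((x \<bullet> p) / r) < 0} = {}"
      by (auto simp: not_less)
    from trans[OF True this[symmetric]] have "geodesic_ball r p 0 ?S"
      unfolding geodesic_ball_def by blast
    then show ?thesis by blast
  next
    case False
    have "closed {x. c \<le> u x}"
      by (intro closed_Collect_le u continuous_on_const)
    then have compact: "compact ?S"
      using compact_Int_closed[OF compact_sphere, of "{x. c \<le> u x}" 0 r] by (simp add: Int_def)
    have "continuous_on ?S (\<lambda>x. x \<bullet> p)" by (intro continuous_intros)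
    then obtain x0 where x0: "x0 \<in> ?S" and min: "\<And>x. x \<in> ?S \<Longrightarrow> x0 \<bullet> p \<le> x \<bullet> p"
      using continuous_attains_inf[OF compact False] by blast
    \<comment> \<open>The lowest point \<open>x0\<close> of the compact superlevel set fixes the
      cap: by monotonicity every point at least as high along p also belongs to it.\<close>
    have "?S = {x \<in> sphere 0 r. x0 \<bullet> p \<le> x \<bullet> p}"
      using x0 min mono[of x0] by (auto intro: order_trans)
    also have "\<dots> = {x \<in> sphere 0 r. arccos ((x \<bullet> p) / r) \<le> arccos ((x0 \<bullet> p) / r)}"
      using bound x0 r by (intro Collect_cong conj_cong refl) (simp add: arccos_le_mono divide_le_cancel)
    finally have "?S = {x \<in> sphere 0 r. arccos ((x \<bullet> p) / r) \<le> arccos ((x0 \<bullet> p) / r)}" .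
    moreover have "0 \<le> arccos ((x0 \<bullet> p) / r)"
      using bound[of x0] x0 by (intro arccos_lbound) (simp_all add: abs_le_iff del: abs_divide)
    ultimately have "geodesic_ball r p (arccos ((x0 \<bullet> p) / r)) ?S"
      unfolding geodesic_ball_def by blast
    then show ?thesis by blast
  qed
qed

section \<open>The polarized function as a competitor\<close>

lemma radial_set_norm:
  fixes \<Omega> :: "(real^'n) set"
  assumes "CARD('n) \<ge> 2" "radial_set \<Omega>" "norm x = norm y" "x \<in> \<Omega>"
  shows "y \<in> \<Omega>"
proof -
  \<comment> \<open>A mirror is not a rotation, so invariance under it goes through whole spheres,
    on which rotations act transitively in dimension at least 2.\<close>
  obtain g where "orthogonal_transformation g" "det (matrix g) = 1" "g x = y"
    using rotation_exists[OF assms(1,3)] by metis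
  then have "g ` \<Omega> = \<Omega>" "g x = y"
    using assms(2) by (auto simp: radial_set_def rotation_def)
  then show ?thesis using assms(4) by blast
qed

lemma cNs_pos: "0 < s \<Longrightarrow> s < 1 \<Longrightarrow> 0 < cNs N s"
  unfolding cNs_def by (auto intro!: mult_pos_pos divide_pos_pos Gamma_real_pos add_nonneg_pos)

text \<open>\<open>polar\<close> preserves the norm and hence \<Omega>, so the integrand is composed
  with a measure-preserving involution. With general \<open>h\<close> this covers both the potential
  term and the constraint.\<close>

lemma set_integral_polar:
  fixes u :: "real^'n \<Rightarrow> real" and h :: "real \<Rightarrow> real \<Rightarrow> real"
  assumes N: "CARD('n) \<ge> 2" and \<Omega>: "radial_set \<Omega>" and u: "u \<in> borel_measurable lebesgue"
  shows "(LINT x:\<Omega>|lebesgue. h (norm x) (u (polar e u x))) = (LINT x:\<Omega>|lebesgue. h (norm x) (u x))"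
proof -
  have "indicator \<Omega> (polar e u x) = (indicator \<Omega> x :: real)" for x
    using radial_set_norm[OF N \<Omega>, of x "polar e u x"] radial_set_norm[OF N \<Omega>, of "polar e u x" x]
    by (auto simp: indicator_def)
  then show ?thesis
    using integral_involution[OF measurable_polar[OF u] distr_polar[OF u] polar_polar,
        of "\<lambda>x. indicator \<Omega> x *\<^sub>R h (norm x) (u x)" e]
    by (simp add: set_lebesgue_integral_def)
qed

lemma Hs0_polar:
  fixes u :: "real^'n \<Rightarrow> real"
  assumes N: "CARD('n) \<ge> 2" and \<Omega>: "radial_set \<Omega>" and u: "u \<in> Hs0 s \<Omega>"
    and fin: "gagliardo s (\<lambda>x. u (polar e u x)) < \<infinity>"
  shows "(\<lambda>x. u (polar e u x)) \<in> Hs0 s \<Omega>"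
proof -
  have um: "u \<in> borel_measurable lebesgue" using u by (simp add: Hs0_def)
  note p = measurable_polar[OF um] distr_polar[OF um] polar_polar
  have "u (polar e u x) = 0" if "x \<notin> \<Omega>" for x
    using that u radial_set_norm[OF N \<Omega>, of "polar e u x" x] by (auto simp: Hs0_def)
  moreover have "integrable lebesgue (\<lambda>x. (u (polar e u x))\<^sup>2)"
    using integrable_involution[OF p, of "\<lambda>x. (u x)\<^sup>2" e] u by (simp add: Hs0_def)
  ultimately show ?thesis
    using fin measurable_compose[OF p(1) um] by (simp add: Hs0_def)
qed

theorem theorem1p4:
  fixes \<Omega> :: "(real^'n) set"
    and f :: "real \<Rightarrow> real \<Rightarrow> real"
    and s q a1 a2 :: real
    and u :: "real^'n \<Rightarrow> real"
  assumes N2: "CARD('n) \<ge> 2"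
    and s: "0 < s" "s < 1"
    and rad: "radial_set \<Omega>" and op: "open \<Omega>"
    and F1: "\<forall>K>0. \<exists>L>0. \<forall>r\<ge>0. \<forall>v w. \<bar>v\<bar> \<le> K \<and> \<bar>w\<bar> \<le> K
                \<longrightarrow> \<bar>f r v - f r w\<bar> \<le> L * \<bar>v - w\<bar>"
    and F2a: "\<forall>r\<ge>0. f r 0 = 0"
    and F2b: "\<exists>\<delta>>0. \<forall>r\<ge>0. \<forall>v. v \<noteq> 0 \<and> \<bar>v\<bar> \<le> \<delta> \<longrightarrow> f r v / v \<le> 0"
    and q: "2 \<le> q" "q \<le> 2 * real CARD('n) / (real CARD('n) - 2 * s)"
    and growth: "\<forall>r\<ge>0. \<forall>v. \<bar>f r v\<bar> \<le> a1 * \<bar>v\<bar> + a2 * \<bar>v\<bar> powr (q - 1)"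
    and uH: "u \<in> Hs0 s \<Omega>"
    and ucont: "continuous_on UNIV u" and ubdd: "bounded (range u)"
    and umin: "(\<forall>v\<in>Hs0 s \<Omega>. energy s \<Omega> f u \<le> energy s \<Omega> f v)
             \<or> (Lq_pow q \<Omega> u = 1 \<and>
                (\<forall>v\<in>Hs0 s \<Omega>. Lq_pow q \<Omega> v = 1 \<longrightarrow> energy s \<Omega> f u \<le> energy s \<Omega> f v))"
    and decay: "(u \<longlongrightarrow> 0) at_infinity"
  shows "\<exists>p. norm p = 1 \<and> foliated_schwarz \<Omega> p u"
proof -
  have um: "u \<in> borel_measurable lebesgue" and fin: "gagliardo s u < \<infinity>"
    using uH by (simp_all add: Hs0_def)
  have "(\<forall>x. 0 \<le> tilt e u x) \<or> (\<forall>x. tilt e u x \<le> 0)" for e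
  proof (rule ccontr)
    assume "\<not> ?thesis"
    then obtain x y where xy: "tilt e u x < 0" "0 < tilt e u y" by (auto simp: not_le)
    define v where "v x = u (polar e u x)" for x
    have less: "gagliardo s v < gagliardo s u"
      unfolding v_def by (rule gagliardo_polar_less[OF s(1) ucont fin xy])
    have v: "v \<in> Hs0 s \<Omega>"
      using Hs0_polar[OF N2 rad uH, of e] less fin unfolding v_def by (simp add: order.strict_trans)
    \<comment> \<open>Makes \<open>v\<close> admissible in the constrained problem as well.\<close>
    have "Lq_pow q \<Omega> v = Lq_pow q \<Omega> u"
      unfolding Lq_pow_def v_def by (rule set_integral_polar[OF N2 rad um, of "\<lambda>_ t. \<bar>t\<bar> powr q"])
    then have "energy s \<Omega> f u \<le> energy s \<Omega> f v"
      using umin v by auto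
    moreover have "(LINT x:\<Omega>|lebesgue. primitive f (norm x) (v x))
        = (LINT x:\<Omega>|lebesgue. primitive f (norm x) (u x))"
      unfolding v_def by (rule set_integral_polar[OF N2 rad um])
    \<comment> \<open>\<open>enn2real\<close> sends infinity to 0, so the finiteness of the energy
      of \<open>u\<close> is what preserves strictness.\<close>
    moreover have "enn2real (gagliardo s v) < enn2real (gagliardo s u)"
      using less fin by (simp add: enn2real_less_iff)
    ultimately show False
      using cNs_pos[OF s, of "CARD('n)"] by (simp add: energy_def)
  qed
  then obtain p where "norm p = 1" "\<And>x y. norm x = norm y \<Longrightarrow> x \<bullet> p \<le> y \<bullet> p \<Longrightarrow> u x \<le> u y"
    using axial_monotone[OF ucont] by blast
  then show ?thesis
    using foliated_schwarz_axial_monotone[OF ucont] by blast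
qed

end
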